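(* Let $n\ge 5$ and let $G$ be a unicyclic graph on $n$ vertices. If $G\not\cong C_n$, then $ER(G)>ER(C_n)$.
   Context: All graphs are finite, simple and undirected. For a graph $G$ on $n$ vertices with adjacency eigenvalues $\lambda_1\ge\cdots\ge\lambda_n$, the resolvent energy is $ER(G)=\sum_{i=1}^n \frac{1}{n-\lambda_i}$. A unicyclic graph is a connected graph with $n$ vertices and $n$ edges. $C_n$ denotes the cycle on $n$ vertices. *)

theory Defs
  imports "Graph_Theory.Graph_Theory" "Jordan_Normal_Form.Char_Poly"
begin

text \<open>
  A finite simple undirected graph is a \<^const>\<open>pair_graph\<close>: an undirected edge \<open>uv\<close> is the pair
  of arcs \<open>(u, v)\<close> and \<open>(v, u)\<close>. Hence the number of edges is the number of unordered pairs below,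
  not the number of arcs.
\<close>

definition undirected_edges :: "'a pair_pre_digraph \<Rightarrow> 'a set set" where
  "undirected_edges G = {{u, v} | u v. (u, v) \<in> parcs G}"

definition unicyclic_graph :: "'a pair_pre_digraph \<Rightarrow> bool" where
  "unicyclic_graph G \<longleftrightarrow>
     pair_graph G \<and> Digraph_Component.connected (with_proj G) \<and>
     card (undirected_edges G) = card (pverts G)"

text \<open>Intended for \<open>n \<ge> 3\<close>: \<open>n = 1\<close> yields a loop and \<open>n = 2\<close> a single edge.\<close>

definition cycle_graph :: "nat \<Rightarrow> nat pair_pre_digraph" where
  "cycle_graph n =
     \<lparr> pverts = {..<n},
       parcs = {(i, j). i < n \<and> j < n \<and> (j = Suc i mod n \<or> i = Suc j mod n)} \<rparr>"

definition adj_mat :: "'a pair_pre_digraph \<Rightarrow> 'a list \<Rightarrow> real mat" where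
  "adj_mat G vs =
     mat (length vs) (length vs) (\<lambda>(i, j). if (vs ! i, vs ! j) \<in> parcs G then 1 else 0)"

text \<open>
  The adjacency eigenvalues with multiplicity, as the multiset of real roots of the characteristic
  polynomial. The vertices are listed in an arbitrary order, which does not affect the result
  (\<open>adj_eigenvalues_eq\<close>); no root is lost by working over the reals, since the adjacency
  matrix is symmetric (\<open>size_adj_eigenvalues\<close>).
\<close>

definition adj_eigenvalues :: "'a pair_pre_digraph \<Rightarrow> real multiset" where
  "adj_eigenvalues G =
     proots (char_poly (adj_mat G (SOME vs. distinct vs \<and> set vs = pverts G)))"

lemma adj_mat_carrier: "adj_mat G vs \<in> carrier_mat (length vs) (length vs)"
  by (simp add: adj_mat_def)

lemma char_poly_adj_mat_eq:
  assumes "distinct vs" "distinct ws" "set vs = set ws"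
  shows "char_poly (adj_mat G vs) = char_poly (adj_mat G ws)"
proof -
  have "mset vs = mset ws"
    using assms by (simp add: set_eq_iff_mset_eq_distinct)
  then obtain p where p: "p permutes {..<length ws}" and pl: "permute_list p ws = vs"
    by (rule mset_eq_permutation)
  define n where "n = length ws"
  have len: "length vs = n" using pl by (auto simp: n_def)
  have pn: "p permutes {0..<n}" using p by (simp add: n_def atLeast0LessThan)
  have pi: "p i < n" if "i < n" for i
    using permutes_in_image[OF pn, of i] that by simp
  have nth: "vs ! i = ws ! p i" if "i < n" for i
    using permute_list_nth[OF p, of i] that pl by (simp add: n_def)
  have inj: "p i = p j \<longleftrightarrow> i = j" for i j
    using permutes_inj[OF pn] by (auto dest: injD)
  define B where "B = char_poly_matrix (adj_mat G ws)"
  have B: "B \<in> carrier_mat n n"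
    unfolding B_def using adj_mat_carrier[of G ws] by (simp add: n_def)
  define C where "C = mat n n (\<lambda>(i, j). B $$ (p i, j))"
  have C: "C \<in> carrier_mat n n" "transpose_mat C \<in> carrier_mat n n"
    by (simp_all add: C_def)
  define D where "D = mat n n (\<lambda>(i, j). transpose_mat C $$ (p i, j))"
  have D: "D \<in> carrier_mat n n" by (simp add: D_def)
  have "char_poly_matrix (adj_mat G vs) = transpose_mat D"
    by (rule eq_matI)
      (auto simp: D_def C_def B_def char_poly_matrix_def adj_mat_def len nth pi inj n_def[symmetric])
  then have "char_poly (adj_mat G vs) = det D"
    by (simp add: char_poly_def det_transpose[OF D])
  also have "\<dots> = signof p * det C"
    unfolding D_def by (simp add: det_permute_rows[OF C(2) pn] det_transpose[OF C(1)])
  also have "\<dots> = signof p * signof p * det B"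
    unfolding C_def by (simp add: det_permute_rows[OF B pn] mult.assoc)
  also have "\<dots> = det B"
    by (simp add: sign_def)
  finally show ?thesis by (simp add: B_def char_poly_def)
qed

lemma adj_eigenvalues_eq:
  assumes "distinct vs" "set vs = pverts G"
  shows "adj_eigenvalues G = proots (char_poly (adj_mat G vs))"
proof -
  define ws where "ws = (SOME ws. distinct ws \<and> set ws = pverts G)"
  have "distinct ws \<and> set ws = pverts G"
    unfolding ws_def by (rule someI[of _ vs]) (use assms in auto)
  then have "char_poly (adj_mat G ws) = char_poly (adj_mat G vs)"
    using assms by (intro char_poly_adj_mat_eq) auto
  then show ?thesis by (simp add: adj_eigenvalues_def ws_def)
qed

lemma eigenvalue_symmetric_real:
  fixes A :: "real mat"
  assumes A: "A \<in> carrier_mat n n"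
    and sym: "\<And>i j. i < n \<Longrightarrow> j < n \<Longrightarrow> A $$ (i, j) = A $$ (j, i)"
    and ev: "eigenvalue (map_mat complex_of_real A) z"
  shows "z \<in> \<real>"
proof -
  let ?A = "map_mat complex_of_real A"
  obtain v where v: "v \<in> carrier_vec n" "v \<noteq> 0\<^sub>v n" and Av: "?A *\<^sub>v v = z \<cdot>\<^sub>v v"
    using ev A by (auto simp: eigenvalue_def eigenvector_def)
  have row: "(\<Sum>j<n. of_real (A $$ (i, j)) * v $ j) = z * v $ i" if "i < n" for i
  proof -
    have "(?A *\<^sub>v v) $ i = z * v $ i" using Av v that by simp
    then show ?thesis
      using A v that by (simp add: scalar_prod_def atLeast0LessThan)
  qed
  define S where "S = (\<Sum>i<n. \<Sum>j<n. cnj (v $ i) * of_real (A $$ (i, j)) * v $ j)"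
  define N where "N = (\<Sum>i<n. (cmod (v $ i))\<^sup>2)"
  have "S = (\<Sum>i<n. cnj (v $ i) * (z * v $ i))"
    unfolding S_def by (intro sum.cong refl) (simp add: row[symmetric] sum_distrib_left mult.assoc)
  also have "\<dots> = z * of_real N"
    unfolding N_def of_real_sum sum_distrib_left
    by (intro sum.cong refl) (simp add: complex_norm_square mult_ac del: of_real_power)
  finally have SN: "S = z * of_real N" .
  have "cnj S = (\<Sum>i<n. \<Sum>j<n. v $ i * of_real (A $$ (i, j)) * cnj (v $ j))"
    by (simp add: S_def)
  also have "\<dots> = (\<Sum>j<n. \<Sum>i<n. v $ i * of_real (A $$ (i, j)) * cnj (v $ j))"
    by (rule sum.swap)
  also have "\<dots> = S"
    unfolding S_def by (intro sum.cong refl) (simp add: sym mult_ac)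
  finally have "cnj z * of_real N = z * of_real N" using SN by simp
  moreover have "N \<noteq> 0"
  proof
    assume "N = 0"
    then have "\<forall>i<n. v $ i = 0" by (simp add: N_def sum_nonneg_eq_0_iff)
    then show False using v by (auto intro: eq_vecI)
  qed
  ultimately have "cnj z = z" by simp
  then show ?thesis by (simp add: Reals_cnj_iff)
qed

lemma size_adj_eigenvalues:
  assumes "pair_graph G"
  shows "size (adj_eigenvalues G) = card (pverts G)"
proof -
  interpret pair_graph G by fact
  obtain vs where vs: "distinct vs" "set vs = pverts G"
    using finite_distinct_list[OF pair_finite_verts] by auto
  define n where "n = length vs"
  define A where "A = adj_mat G vs"
  have n: "n = card (pverts G)" using distinct_card[OF vs(1)] vs(2) by (simp add: n_def)
  have A: "A \<in> carrier_mat n n" unfolding A_def n_def by (rule adj_mat_carrier)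
  have "sym (parcs G)" using pair_sym_arcs by (simp add: symmetric_def)
  then have symA: "A $$ (i, j) = A $$ (j, i)" if "i < n" "j < n" for i j
    using that by (auto simp: A_def adj_mat_def n_def dest: symD)
  let ?A = "map_mat complex_of_real A"
  have cA: "?A \<in> carrier_mat n n" using A by simp
  obtain as where as: "char_poly ?A = (\<Prod>a\<leftarrow>as. [:- a, 1:])" "length as = n"
    using char_poly_factorized[OF cA] by auto
  have real: "of_real (Re a) = a" if "a \<in> set as" for a
  proof -
    have "poly (char_poly ?A) a = 0"
      unfolding as(1) using that by (auto simp: poly_prod_list prod_list_zero_iff)
    then have "eigenvalue ?A a" by (simp add: eigenvalue_root_char_poly[OF cA])
    then have "a \<in> \<real>" using eigenvalue_symmetric_real[OF A] symA by blast
    then show ?thesis by (simp add: of_real_Re)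
  qed
  interpret mh: map_poly_inj_comm_ring_hom complex_of_real ..
  have "map_poly complex_of_real (\<Prod>a\<leftarrow>as. [:- Re a, 1:]) = (\<Prod>a\<leftarrow>as. [:- a, 1:])"
    using real by (induction as) (simp_all add: mh.hom_mult del: mult_pCons_left)
  also have "\<dots> = map_poly complex_of_real (char_poly A)"
    unfolding as(1)[symmetric] by (rule of_real_hom.char_poly_hom[OF A])
  finally have "char_poly A = (\<Prod>a\<leftarrow>as. [:- Re a, 1:])"
    by (metis mh.injectivity)
  moreover have "size (proots (\<Prod>a\<leftarrow>as. [:- Re a, 1:])) = length as"
  proof (induction as)
    case (Cons a as)
    have "(\<Prod>a\<leftarrow>as. [:- Re a, 1:]) \<noteq> 0" by (auto simp: prod_list_zero_iff)
    moreover have "size (proots [:- Re a, 1:]) = 1" by simp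
    ultimately show ?case using Cons by (simp add: proots_mult del: mult_pCons_left)
  qed simp
  ultimately show ?thesis
    using adj_eigenvalues_eq[OF vs] as(2) n by (simp add: A_def)
qed

definition resolvent_energy :: "'a pair_pre_digraph \<Rightarrow> real" where
  "resolvent_energy G = (\<Sum>x\<in>#adj_eigenvalues G. 1 / (real (card (pverts G)) - x))"

end

theory Submission
  imports Defs "Jordan_Normal_Form.Schur_Decomposition"
begin

text \<open>
  Put \<open>w(x) = x\<^sup>3 - 3x\<close>, so that \<open>w(2 cos t) = 2 cos 3t\<close>. Then
  \<open>1 / (n - x) = p(x) + w(x)\<^sup>2 / (w(n)\<^sup>2 (n - x))\<close>, where \<open>p\<close> is the polynomial of degree 5
  interpolating \<open>1 / (n - x)\<close> to second order at the roots of \<open>w\<close>; for \<open>n \<ge> 5\<close> its coefficients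
  are nonnegative. Hence \<open>ER\<close> is controlled by the spectral moments \<open>M\<^sub>k = tr A\<^sup>k\<close> with \<open>k \<le> 5\<close>,
  up to a nonnegative remainder.
  All unicyclic graphs on \<open>n\<close> vertices share \<open>M\<^sub>1 = 0\<close> and \<open>M\<^sub>2 = 2n\<close>. For the cycle \<open>M\<^sub>3 = 0\<close>,
  \<open>M\<^sub>4 = 6n\<close>, \<open>M\<^sub>5 \<le> 2n\<close>, and the spectrum lies in \<open>[-2, 2]\<close>, where \<open>w\<^sup>2 \<le> 4\<close>, so the remainder
  is less than \<open>2n / w(n)\<^sup>2\<close>. For any other unicyclic graph some degree differs from 2, which forces
  \<open>M\<^sub>4 \<ge> 6n + 4\<close>, while \<open>M\<^sub>3, M\<^sub>5 \<ge> 0\<close>. As \<open>M\<^sub>4\<close> has weight \<open>n / w(n)\<^sup>2\<close> in \<open>p\<close>, its excess \<open>4\<close>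
  outweighs the fifth moment and the remainder of the cycle.
\<close>

subsection \<open>Power sums of eigenvalues as traces\<close>

text \<open>Splitting off a root \<open>x\<close> leaves a cofactor whose root multiset has lost
  exactly one copy of \<open>x\<close>, so the rest of \<open>M\<close> still fits inside it. Hence
  the induction with \<open>p\<close> arbitrary.\<close>

lemma prod_mset_linear_factors_dvd:
  fixes p :: "'a :: field poly"
  assumes "p \<noteq> 0" "M \<subseteq># proots p"
  shows "(\<Prod>x\<in>#M. [:- x, 1:]) dvd p"
  using assms
proof (induction M arbitrary: p)
  case (add x M)
  have "x \<in># proots p" using add.prems(2) by (meson mset_subset_eqD union_single_eq_member)
  then have "poly p x = 0" using add.prems(1) by simp
  then obtain q where q: "p = [:- x, 1:] * q" by (auto simp: poly_eq_0_iff_dvd)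
  then have "q \<noteq> 0" using add.prems(1) by auto
  then have "proots p = add_mset x (proots q)"
    unfolding q by (subst proots_mult) auto
  then have "M \<subseteq># proots q" using add.prems(2) by simp
  from add.IH[OF \<open>q \<noteq> 0\<close> this] show ?case
    unfolding q by (simp del: mult_pCons_left add: mult_dvd_mono)
qed simp

text \<open>The product of linear factors divides \<open>p\<close>. The size hypothesis, which says
  that \<open>p\<close> splits, makes the cofactor constant, and the leading coefficients make it
  1.\<close>

lemma monic_eq_prod_mset_proots:
  fixes p :: "'a :: field poly"
  assumes "monic p" "size (proots p) = degree p"
  shows "p = (\<Prod>x\<in>#proots p. [:- x, 1:])"
proof -
  let ?r = "\<Prod>x\<in>#proots p. [:- x, 1:]"
  have monic: "monic (\<Prod>x\<in>#M. [:- x, 1:])" for M :: "'a multiset"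
    by (induction M) (auto simp: monic_mult simp del: mult_pCons_left)
  have nz: "(\<Prod>x\<in>#M. [:- x, 1:]) \<noteq> 0" for M :: "'a multiset"
    using monic[of M] by auto
  have deg: "degree (\<Prod>x\<in>#M. [:- x, 1:]) = size M" for M :: "'a multiset"
    using nz by (induction M) (simp_all add: degree_mult_eq del: mult_pCons_left)
  have p0: "p \<noteq> 0" using assms(1) by auto
  obtain q where q: "p = ?r * q"
    using prod_mset_linear_factors_dvd[OF p0 subset_mset.refl] by (auto elim: dvdE)
  then have q0: "q \<noteq> 0" using p0 by auto
  have "degree p = degree ?r + degree q"
    by (subst q, rule degree_mult_eq) (use nz q0 in auto)
  then have "degree q = 0" using deg assms(2) by simp
  moreover have "lead_coeff q = 1"
    using assms(1) monic[of "proots p"] lead_coeff_mult[of ?r q] q by simp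
  ultimately have "q = 1"
    by (metis degree_0_id one_pCons)
  with q show ?thesis by simp
qed

section \<open>Traces under similarity and triangularisation\<close>

lemma sum_diag_mult_commute:
  fixes A B :: "'a :: comm_semiring_0 mat"
  assumes "A \<in> carrier_mat n n" "B \<in> carrier_mat n n"
  shows "(\<Sum>i<n. (A * B) $$ (i, i)) = (\<Sum>i<n. (B * A) $$ (i, i))"
proof -
  have "(\<Sum>i<n. (A * B) $$ (i, i)) = (\<Sum>i<n. \<Sum>j<n. A $$ (i, j) * B $$ (j, i))"
    using assms by (intro sum.cong refl) (simp add: scalar_prod_def atLeast0LessThan)
  also have "\<dots> = (\<Sum>j<n. \<Sum>i<n. B $$ (j, i) * A $$ (i, j))"
    by (subst sum.swap) (simp add: mult.commute)
  also have "\<dots> = (\<Sum>i<n. (B * A) $$ (i, i))"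
    using assms by (intro sum.cong refl) (simp add: scalar_prod_def atLeast0LessThan)
  finally show ?thesis .
qed

lemma sum_diag_similar:
  fixes A B :: "'a :: comm_ring_1 mat"
  assumes A: "A \<in> carrier_mat n n" and sim: "similar_mat_wit A B P Q"
  shows "(\<Sum>i<n. A $$ (i, i)) = (\<Sum>i<n. B $$ (i, i))"
proof -
  note s = similar_mat_witD2[OF A sim]
  have "(\<Sum>i<n. A $$ (i, i)) = (\<Sum>i<n. ((P * B) * Q) $$ (i, i))"
    using s by simp
  also have "\<dots> = (\<Sum>i<n. (Q * (P * B)) $$ (i, i))"
    by (rule sum_diag_mult_commute) (use s in auto)
  also have "Q * (P * B) = (Q * P) * B"
    using s by (subst assoc_mult_mat[of _ n n _ n _ n]) auto
  also have "\<dots> = B" using s by simp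
  finally show ?thesis .
qed

lemma upper_triangular_pow:
  fixes B :: "'a :: comm_ring_1 mat"
  assumes B: "B \<in> carrier_mat n n" "upper_triangular B"
  shows "upper_triangular (B ^\<^sub>m k) \<and> (\<forall>i<n. (B ^\<^sub>m k) $$ (i, i) = (B $$ (i, i)) ^ k)"
proof (induction k)
  case 0
  show ?case using B by (auto intro!: upper_triangularI)
next
  case (Suc k)
  have C: "B ^\<^sub>m k \<in> carrier_mat n n" using B by simp
  have zB: "B $$ (i, j) = 0" if "j < i" "i < n" for i j
    using that B upper_triangularD by (metis carrier_matD(1))
  have zC: "(B ^\<^sub>m k) $$ (i, j) = 0" if "j < i" "i < n" for i j
    using that Suc.IH C upper_triangularD by (metis carrier_matD(1))
  have ent: "(B ^\<^sub>m k * B) $$ (i, j) = (\<Sum>l<n. (B ^\<^sub>m k) $$ (i, l) * B $$ (l, j))"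
    if "i < n" "j < n" for i j
    using that B C by (simp add: scalar_prod_def atLeast0LessThan)
  have "(B ^\<^sub>m k * B) $$ (i, j) = 0" if "j < i" "i < n" for i j
    unfolding ent[OF that(2) less_trans[OF that]]
  proof (intro sum.neutral ballI)
    \<comment> \<open>If \<open>l < i\<close>, the left factor lies below the diagonal; otherwise
      \<open>j < i \<le> l\<close> and the right factor does.\<close>
    fix l assume "l \<in> {..<n}"
    then show "(B ^\<^sub>m k) $$ (i, l) * B $$ (l, j) = 0"
      using zB[of j l] zC[of l i] that by (cases "l < i") auto
  qed
  moreover have "(B ^\<^sub>m k * B) $$ (i, i) = (B $$ (i, i)) ^ Suc k" if i: "i < n" for i
  proof -
    have "(B ^\<^sub>m k * B) $$ (i, i) = (\<Sum>l\<in>{i}. (B ^\<^sub>m k) $$ (i, l) * B $$ (l, i))"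
      unfolding ent[OF i i]
    proof (rule sum.mono_neutral_right)
      show "\<forall>l\<in>{..<n} - {i}. (B ^\<^sub>m k) $$ (i, l) * B $$ (l, i) = 0"
      proof
        fix l assume "l \<in> {..<n} - {i}"
        then show "(B ^\<^sub>m k) $$ (i, l) * B $$ (l, i) = 0"
          using zB[of i l] zC[of l i] i by (cases "l < i") auto
      qed
    qed (use i in auto)
    then show ?thesis using Suc.IH i by simp
  qed
  ultimately show ?case using B by (auto intro!: upper_triangularI)
qed

text \<open>Since the characteristic polynomial splits over the reals, a real Schur decomposition
  exists. It makes \<open>A\<close> similar to a triangular matrix with the eigenvalues on the
  diagonal, and the trace of each power survives the similarity.\<close>

lemma sum_power_proots_char_poly:
  fixes A :: "real mat"
  assumes A: "A \<in> carrier_mat n n" and split: "size (proots (char_poly A)) = n"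
  shows "(\<Sum>x\<in>#proots (char_poly A). x ^ k) = (\<Sum>i<n. (A ^\<^sub>m k) $$ (i, i))"
proof -
  have "monic (char_poly A)" "degree (char_poly A) = n"
    using degree_monic_char_poly[OF A] by auto
  then have "char_poly A = (\<Prod>x\<in>#proots (char_poly A). [:- x, 1:])"
    using monic_eq_prod_mset_proots split by metis
  moreover obtain es where es: "mset es = proots (char_poly A)"
    using ex_mset by blast
  ultimately have cp: "char_poly A = (\<Prod>x\<leftarrow>es. [:- x, 1:])"
    by (metis mset_map prod_mset_prod_list)
  obtain B P Q where "schur_decomposition A es = (B, P, Q)"
    by (cases "schur_decomposition A es") auto
  from schur_decomposition[OF A cp this]
  have sim: "similar_mat_wit A B P Q" and B: "upper_triangular B" "diag_mat B = es" by auto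
  have Bn: "B \<in> carrier_mat n n" using similar_mat_witD2[OF A sim] by simp
  have "(\<Sum>i<n. (A ^\<^sub>m k) $$ (i, i)) = (\<Sum>i<n. (B ^\<^sub>m k) $$ (i, i))"
    using sum_diag_similar[OF _ similar_mat_wit_pow[OF sim]] A by simp
  also have "\<dots> = (\<Sum>i<n. (B $$ (i, i)) ^ k)"
    using upper_triangular_pow[OF Bn B(1)] by simp
  also have "\<dots> = (\<Sum>x\<leftarrow>es. x ^ k)"
    using B(2) Bn by (auto simp: diag_mat_def o_def interv_sum_list_conv_sum_set_nat atLeast0LessThan)
  also have "\<dots> = (\<Sum>x\<in>#proots (char_poly A). x ^ k)"
    by (metis es mset_map sum_mset_sum_list)
  finally show ?thesis by simp
qed

text \<open>Read the eigenvalue equation in a row \<open>i\<close> where the eigenvector has an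
  entry of largest absolute value \<open>m\<close>, then cancel \<open>m\<close>.\<close>

lemma abs_eigenvalue_le_row_sum:
  fixes A :: "real mat"
  assumes A: "A \<in> carrier_mat n n" and x: "poly (char_poly A) x = 0"
    and D: "\<And>i. i < n \<Longrightarrow> (\<Sum>j<n. \<bar>A $$ (i, j)\<bar>) \<le> D"
  shows "\<bar>x\<bar> \<le> D"
proof -
  have "eigenvalue A x" using x by (simp add: eigenvalue_root_char_poly[OF A])
  then obtain v where v: "v \<in> carrier_vec n" "v \<noteq> 0\<^sub>v n" and Av: "A *\<^sub>v v = x \<cdot>\<^sub>v v"
    using A by (auto simp: eigenvalue_def eigenvector_def)
  have "n \<noteq> 0" using v by (metis carrier_vecD dim_vec eq_vecI index_zero_vec(2) less_nat_zero_code)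
  define m where "m = Max ((\<lambda>i. \<bar>v $ i\<bar>) ` {..<n})"
  have "m \<in> (\<lambda>i. \<bar>v $ i\<bar>) ` {..<n}"
    unfolding m_def using \<open>n \<noteq> 0\<close> by (intro Max_in) auto
  then obtain i where i: "i < n" "m = \<bar>v $ i\<bar>" by auto
  have le: "\<bar>v $ j\<bar> \<le> m" if "j < n" for j
    unfolding m_def using that by (intro Max_ge) auto
  have "m > 0"
  proof (rule ccontr)
    assume "\<not> m > 0"
    then have "v $ j = 0" if "j < n" for j using le[OF that] by linarith
    then have "v = 0\<^sub>v n" using v(1) by (intro eq_vecI) auto
    with v(2) show False by simp
  qed
  have "x * v $ i = (\<Sum>j<n. A $$ (i, j) * v $ j)"
  proof -
    have "(A *\<^sub>v v) $ i = x * v $ i" using Av v i by simp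
    then show ?thesis using A v i by (simp add: scalar_prod_def atLeast0LessThan)
  qed
  then have "\<bar>x\<bar> * m = \<bar>\<Sum>j<n. A $$ (i, j) * v $ j\<bar>" using i by (simp add: abs_mult[symmetric])
  also have "\<dots> \<le> (\<Sum>j<n. \<bar>A $$ (i, j)\<bar> * \<bar>v $ j\<bar>)"
    by (rule order.trans[OF sum_abs]) (simp add: abs_mult)
  also have "\<dots> \<le> (\<Sum>j<n. \<bar>A $$ (i, j)\<bar> * m)"
    by (intro sum_mono mult_left_mono le) auto
  also have "\<dots> = (\<Sum>j<n. \<bar>A $$ (i, j)\<bar>) * m" by (simp add: sum_distrib_right)
  also have "\<dots> \<le> D * m" using D[OF i(1)] \<open>m > 0\<close> by simp
  finally show ?thesis using \<open>m > 0\<close> by simp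
qed

subsection \<open>Connected 2-regular graphs are cycles\<close>

definition neighbours :: "'a pair_pre_digraph \<Rightarrow> 'a \<Rightarrow> 'a set" where
  "neighbours G v = {w. (v, w) \<in> parcs G}"

context pair_graph
begin

lemma parcs_sym: "(u, v) \<in> parcs G \<longleftrightarrow> (v, u) \<in> parcs G"
  using pair_sym_arcs by (auto simp: symmetric_def dest: symD)

lemma parcs_irrefl: "(v, v) \<notin> parcs G"
  using pair_no_loops[of "(v, v)"] by auto

lemma neighbours_subset: "neighbours G v \<subseteq> pverts G - {v}"
  using arc_snd_in_verts parcs_irrefl by (fastforce simp: neighbours_def)

lemma finite_neighbours: "finite (neighbours G v)"
  using neighbours_subset pair_finite_verts by (meson finite_Diff finite_subset)

lemma card_neighbours_less:
  assumes "v \<in> pverts G"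
  shows "card (neighbours G v) < card (pverts G)"
  using assms neighbours_subset pair_finite_verts
  by (intro psubset_card_mono) blast+

lemma sum_card_neighbours: "(\<Sum>v\<in>pverts G. card (neighbours G v)) = card (parcs G)"
proof -
  have "parcs G = Sigma (pverts G) (neighbours G)"
    using arc_fst_in_verts by (fastforce simp: neighbours_def)
  then show ?thesis
    using finite_neighbours pair_finite_verts by simp
qed

text \<open>The map from arcs to their endpoint sets has fibres \<open>{(u, v), (v, u)}\<close>, of
  size two because there are no loops.\<close>

lemma card_parcs: "card (parcs G) = 2 * card (undirected_edges G)"
proof -
  define ends where "ends = (\<lambda>a :: 'a \<times> 'a. {fst a, snd a})"
  have edges: "undirected_edges G = ends ` parcs G"
    by (force simp: undirected_edges_def ends_def)
  have fibre: "card {a \<in> parcs G. ends a = e} = 2" if "e \<in> ends ` parcs G" for e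
  proof -
    obtain u v where uv: "(u, v) \<in> parcs G" "e = {u, v}"
      using \<open>e \<in> ends ` parcs G\<close> by (auto simp: ends_def)
    then have "{a \<in> parcs G. ends a = e} = {(u, v), (v, u)}"
      using parcs_sym by (auto simp: ends_def doubleton_eq_iff)
    moreover have "u \<noteq> v" using uv parcs_irrefl by blast
    ultimately show ?thesis by simp
  qed
  have "card (parcs G) = (\<Sum>a\<in>parcs G. 1)" by simp
  also have "\<dots> = (\<Sum>e\<in>ends ` parcs G. \<Sum>a\<in>{a \<in> parcs G. ends a = e}. 1)"
    by (rule sum.image_gen) (rule pair_finite_arcs)
  also have "\<dots> = (\<Sum>e\<in>ends ` parcs G. 2)"
    using fibre by (intro sum.cong) auto
  finally show ?thesis by (simp add: edges)
qed

text \<open>Arcs are symmetric, so connectedness yields directed reachability from a vertex of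
  \<open>S\<close>, and closure keeps every such walk inside \<open>S\<close>.\<close>

lemma connected_closed_set_eq_pverts:
  assumes "Digraph_Component.connected (with_proj G)"
    and S: "S \<subseteq> pverts G" "S \<noteq> {}"
    and closed: "\<And>v. v \<in> S \<Longrightarrow> neighbours G v \<subseteq> S"
  shows "S = pverts G"
proof (intro equalityI S subsetI)
  fix v assume v: "v \<in> pverts G"
  obtain u where u: "u \<in> S" using S by blast
  have "strongly_connected (with_proj G)"
    using assms(1) by (intro symmetric_connected_imp_strongly_connected) auto
  then have "u \<rightarrow>\<^sup>*\<^bsub>with_proj G\<^esub> v"
    using u v S by (auto simp: strongly_connected_def)
  then show "v \<in> S"
  proof (induction rule: reachable_induct)
    case base
    show ?case by (rule u)
  next
    case (step x y)
    then show ?case using closed[of x] by (auto simp: neighbours_def)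
  qed
qed

text \<open>The general notion of isomorphism also carries a map on arcs; for arcs that are pairs it
  is induced by the vertex map as \<open>map_prod f f\<close>.\<close>

lemma digraph_iso_with_projI:
  fixes H :: "'b pair_pre_digraph"
  assumes bij: "bij_betw f (pverts G) (pverts H)"
    and arcs: "\<And>u v. u \<in> pverts G \<Longrightarrow> v \<in> pverts G \<Longrightarrow> (f u, f v) \<in> parcs H \<longleftrightarrow> (u, v) \<in> parcs G"
    and H: "parcs H \<subseteq> pverts H \<times> pverts H"
  shows "digraph_iso (with_proj G) (with_proj H)"
proof -
  define h where "h = \<lparr>iso_verts = f, iso_arcs = map_prod f f, iso_head = snd, iso_tail = fst\<rparr>"
  have inj: "inj_on f (pverts G)" and im: "f ` pverts G = pverts H"
    using bij by (auto simp: bij_betw_def)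
  have sub: "parcs G \<subseteq> pverts G \<times> pverts G"
    using arc_fst_in_verts arc_snd_in_verts by fastforce
  have "inj_on (map_prod f f) (parcs G)"
    using map_prod_inj_on[OF inj inj] sub by (rule inj_on_subset)
  then have "digraph_isomorphism h"
    using inj by (auto simp: digraph_isomorphism_def h_def wf_digraph)
  moreover have "map_prod f f ` parcs G = parcs H"
  proof (intro equalityI subsetI)
    fix a assume "a \<in> map_prod f f ` parcs G"
    then show "a \<in> parcs H" using sub arcs by fastforce
  next
    fix a assume a: "a \<in> parcs H"
    then obtain u v where "u \<in> pverts G" "v \<in> pverts G" "a = (f u, f v)"
      using H im by (cases a) blast
    then show "a \<in> map_prod f f ` parcs G" using a arcs by force
  qed
  then have "with_proj H = app_iso h (with_proj G)"
    using im by (simp add: app_iso_def h_def with_proj_def)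
  ultimately show ?thesis by (auto simp: digraph_iso_def)
qed

text \<open>Walk without turning back. By finiteness the walk meets itself, first at its start, and
  the vertices seen so far are closed under neighbours, hence all of \<open>G\<close>. Numbering
  them along the walk gives the isomorphism.\<close>

lemma connected_2_regular_imp_cycle:
  assumes conn: "Digraph_Component.connected (with_proj G)"
    and reg: "\<And>v. v \<in> pverts G \<Longrightarrow> card (neighbours G v) = 2"
    and n: "card (pverts G) = n"
  shows "digraph_iso (with_proj G) (with_proj (cycle_graph n))"
proof -
  have nb_V: "w \<in> pverts G" if "w \<in> neighbours G v" for v w
    using that neighbours_subset by blast
  have nb_sym: "w \<in> neighbours G v \<longleftrightarrow> v \<in> neighbours G w" for v w
    using parcs_sym by (simp add: neighbours_def)
  have nb_irrefl: "v \<notin> neighbours G v" for v using parcs_irrefl by (simp add: neighbours_def)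
  have nb_eq: "neighbours G v = {a, b}"
    if "v \<in> pverts G" "a \<in> neighbours G v" "b \<in> neighbours G v" "a \<noteq> b" for v a b
    using that reg[of v] finite_neighbours[of v]
    by (intro card_seteq[symmetric]) auto
  obtain v0 where v0: "v0 \<in> pverts G"
    using conn by (auto simp: Digraph_Component.connected_def strongly_connected_def)
  then obtain v1 where v1: "v1 \<in> neighbours G v0"
    using reg[of v0] by fastforce
  have other: "\<exists>w. w \<in> neighbours G v \<and> w \<noteq> u" if "v \<in> pverts G" for u v
  proof (rule ccontr)
    assume "\<not> ?thesis"
    then have "neighbours G v \<subseteq> {u}" by blast
    then have "card (neighbours G v) \<le> card {u}" by (intro card_mono) auto
    then show False using reg[OF that] by simp
  qed
  \<comment> \<open>The walk is chosen as a sequence of arcs, because the next vertex must avoid the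
    previous one as well as be adjacent to the current one.\<close>
  have "\<exists>g. \<forall>k. (g k \<in> parcs G \<and> (k = 0 \<longrightarrow> g k = (v0, v1))) \<and>
      fst (g (Suc k)) = snd (g k) \<and> snd (g (Suc k)) \<noteq> fst (g k)"
  proof (rule dependent_nat_choice)
    show "\<exists>x. x \<in> parcs G \<and> (0 = (0::nat) \<longrightarrow> x = (v0, v1))"
      using v1 by (auto simp: neighbours_def)
  next
    fix x :: "'a \<times> 'a" and k :: nat assume "x \<in> parcs G \<and> (k = 0 \<longrightarrow> x = (v0, v1))"
    then show "\<exists>y. (y \<in> parcs G \<and> (Suc k = 0 \<longrightarrow> y = (v0, v1))) \<and> fst y = snd x \<and> snd y \<noteq> fst x"
      using other[of "snd x" "fst x"] arc_snd_in_verts by (fastforce simp: neighbours_def)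
  qed
  then obtain g where g: "\<And>k. g k \<in> parcs G" "\<And>k. fst (g (Suc k)) = snd (g k)"
    "\<And>k. snd (g (Suc k)) \<noteq> fst (g k)" by blast
  define f where "f k = fst (g k)" for k
  have f_Suc: "f (Suc k) \<in> neighbours G (f k)" for k
    using g(1)[of k] by (simp add: f_def g(2) neighbours_def)
  have f_Suc2: "f (Suc (Suc k)) \<noteq> f k" for k
    using g(3)[of k] by (simp add: f_def g(2))
  have f_V: "f k \<in> pverts G" for k
    using f_Suc nb_sym nb_V by blast
  have nb_f: "neighbours G (f (Suc k)) = {f k, f (Suc (Suc k))}" for k
    using nb_eq[OF f_V, of "f k" "Suc k" "f (Suc (Suc k))"] f_Suc f_Suc2 nb_sym by metis
  have "\<not> inj f"
    using finite_subset[OF _ pair_finite_verts] f_V by (meson finite_imageD image_subsetI infinite_UNIV_nat)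
  then have ex: "\<exists>p. \<exists>j<p. f p = f j"
    unfolding inj_def by (metis linorder_neq_iff)
  \<comment> \<open>The first repetition of the non-backtracking walk \<open>f\<close> is a return to its start.\<close>
  define p where "p = (LEAST p. \<exists>j<p. f p = f j)"
  obtain j where j: "j < p" "f p = f j"
    using LeastI_ex[OF ex] unfolding p_def by blast
  have min: "\<not> (\<exists>j<q. f q = f j)" if "q < p" for q
    using that not_less_Least unfolding p_def by blast
  have inj: "inj_on f {..<p}"
    by (rule linorder_inj_onI) (use min in \<open>auto, metis\<close>)
  have f_eq: "f a = f b \<longleftrightarrow> a = b" if "a < p" "b < p" for a b
    using inj that by (auto simp: inj_on_def)
  have p3: "p \<ge> 3"
  proof -
    have "p \<noteq> Suc 0" using j f_Suc[of 0] nb_irrefl by auto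
    moreover have "p \<noteq> Suc (Suc 0)"
      using j f_Suc[of "Suc 0"] f_Suc2[of 0] nb_irrefl by (auto simp: less_Suc_eq)
    ultimately show ?thesis using j by linarith
  qed
  then obtain q where q: "p = Suc q" "q \<ge> 2" by (cases p) auto
  \<comment> \<open>If \<open>j = Suc i\<close>, then \<open>f q\<close> is a neighbour of
    \<open>f j\<close>, so it is \<open>f i\<close> or \<open>f (Suc j)\<close>. Injectivity below
    \<open>p\<close> excludes the first; the second forces \<open>q = Suc j\<close>, and the step to
    \<open>f p = f j\<close> would turn back.\<close>
  have j0: "j = 0"
  proof (rule ccontr)
    assume "j \<noteq> 0"
    then obtain i where i: "j = Suc i" by (cases j) auto
    have "f q \<in> neighbours G (f j)"
      using f_Suc[of q] j(2) q(1) nb_sym by metis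
    then have "f q = f i \<or> f q = f (Suc j)"
      using nb_f[of i] i by simp
    moreover have "f q \<noteq> f i" using f_eq[of q i] j i q by auto
    ultimately have eq: "f q = f (Suc j)" by simp
    have "Suc j \<noteq> p" using f_Suc[of j] j(2) nb_irrefl by metis
    then have "q = Suc j" using eq f_eq[of q "Suc j"] j q by auto
    then show False using f_Suc2[of j] j(2) q(1) by simp
  qed
  then have fp: "f p = f 0" using j by simp
  \<comment> \<open>The start has no predecessor on the walk; closing up at \<open>p\<close>
    supplies \<open>f q\<close> as its second neighbour.\<close>
  have nb_0: "neighbours G (f 0) = {f q, f 1}"
  proof (rule nb_eq)
    show "f q \<in> neighbours G (f 0)" using f_Suc[of q] fp q(1) nb_sym by metis
    show "f 1 \<in> neighbours G (f 0)" using f_Suc[of 0] by simp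
    show "f q \<noteq> f 1" using f_eq[of q 1] q by auto
  qed (rule f_V)
  have nb: "neighbours G (f i) = f ` {k. k < p \<and> (k = Suc i mod p \<or> i = Suc k mod p)}" (is "_ = f ` ?N")
    if "i < p" for i
  proof (cases i)
    case 0
    have "?N = {q, 1}" using 0 q by (auto simp: mod_Suc split: if_splits)
    then show ?thesis using nb_0 0 by simp
  next
    case (Suc k)
    \<comment> \<open>This includes \<open>i = q\<close>, where the index wraps to 0 and
      \<open>f p = f 0\<close>.\<close>
    have fm: "f (Suc i mod p) = f (Suc i)" using that fp by (simp add: mod_Suc)
    have "?N = {k, Suc i mod p}" using Suc that q by (auto simp: mod_Suc split: if_splits)
    then show ?thesis using nb_f[of k] fm Suc by simp
  qed
  have V: "f ` {..<p} = pverts G"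
  proof (rule connected_closed_set_eq_pverts[OF conn])
    show "neighbours G v \<subseteq> f ` {..<p}" if "v \<in> f ` {..<p}" for v
      using that nb by auto
  qed (use f_V p3 in \<open>auto simp: lessThan_empty_iff\<close>)
  have "p = n" using card_image[OF inj] V n by simp
  have bij: "bij_betw f {..<n} (pverts G)" using V inj \<open>p = n\<close> by (simp add: bij_betw_def)
  \<comment> \<open>The numbering \<open>f\<close> runs from the cycle to \<open>G\<close>, so the
    isomorphism is its inverse.\<close>
  show ?thesis
  proof (rule digraph_iso_with_projI)
    show "bij_betw (the_inv_into {..<n} f) (pverts G) (pverts (cycle_graph n))"
      using bij_betw_the_inv_into[OF bij] by (simp add: cycle_graph_def)
  next
    fix u v assume "u \<in> pverts G" "v \<in> pverts G"
    then obtain a b where ab: "a < n" "b < n" "u = f a" "v = f b"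
      using V \<open>p = n\<close> by blast
    have inv: "the_inv_into {..<n} f (f i) = i" if "i < n" for i
      using inj that \<open>p = n\<close> by (simp add: the_inv_into_f_f)
    have "(u, v) \<in> parcs G \<longleftrightarrow> f b \<in> neighbours G (f a)" using ab by (simp add: neighbours_def)
    also have "\<dots> \<longleftrightarrow> b = Suc a mod n \<or> a = Suc b mod n"
      using nb[of a] ab f_eq \<open>p = n\<close> by auto
    finally show "(the_inv_into {..<n} f u, the_inv_into {..<n} f v) \<in> parcs (cycle_graph n) \<longleftrightarrow> (u, v) \<in> parcs G"
      using ab inv by (simp add: cycle_graph_def)
  qed (auto simp: cycle_graph_def)
qed

end

subsection \<open>Spectral moments of a graph\<close>

context pair_graph
begin

lemma sum_power_adj_eigenvalues:
  assumes vs: "distinct vs" "set vs = pverts G"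
  shows "(\<Sum>x\<in>#adj_eigenvalues G. x ^ k) = (\<Sum>i<length vs. (adj_mat G vs ^\<^sub>m k) $$ (i, i))"
proof -
  have "size (proots (char_poly (adj_mat G vs))) = length vs"
    using size_adj_eigenvalues[OF pair_graph] adj_eigenvalues_eq[OF vs] distinct_card[OF vs(1)] vs(2)
    by simp
  then show ?thesis
    unfolding adj_eigenvalues_eq[OF vs] by (rule sum_power_proots_char_poly[OF adj_mat_carrier])
qed

text \<open>The absolute row sums of the adjacency matrix are the vertex degrees.\<close>

lemma abs_adj_eigenvalue_le:
  assumes x: "x \<in># adj_eigenvalues G"
    and D: "\<And>v. v \<in> pverts G \<Longrightarrow> real (card (neighbours G v)) \<le> D"
  shows "\<bar>x\<bar> \<le> D"
proof -
  obtain vs where vs: "distinct vs" "set vs = pverts G"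
    using finite_distinct_list[OF pair_finite_verts] by auto
  let ?A = "adj_mat G vs" and ?n = "length vs"
  have "poly (char_poly ?A) x = 0"
    using x degree_monic_char_poly[OF adj_mat_carrier[of G vs]] unfolding adj_eigenvalues_eq[OF vs]
    by (cases "char_poly ?A = 0") auto
  moreover have "(\<Sum>j<?n. \<bar>?A $$ (i, j)\<bar>) \<le> D" if i: "i < ?n" for i
  proof -
    have "(\<Sum>j<?n. \<bar>?A $$ (i, j)\<bar>) = (\<Sum>j<?n. of_bool ((vs ! i, vs ! j) \<in> parcs G))"
      using i by (intro sum.cong) (auto simp: adj_mat_def)
    also have "\<dots> = (\<Sum>v\<in>pverts G. of_bool ((vs ! i, v) \<in> parcs G))"
      by (rule sum.reindex_bij_betw[OF bij_betw_nth]) (use vs in auto)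
    also have "\<dots> = real (card (neighbours G (vs ! i)))"
      using neighbours_subset[of "vs ! i"] pair_finite_verts
      by (auto simp: of_bool_def sum.If_cases neighbours_def intro!: arg_cong[where f = card])
    also have "\<dots> \<le> D" using D i vs(2) by (metis nth_mem)
    finally show ?thesis .
  qed
  ultimately show ?thesis using abs_eigenvalue_le_row_sum[OF adj_mat_carrier] by blast
qed

text \<open>The moment is the trace of a power of an entrywise nonnegative matrix. The induction
  covers all entries, since the diagonal alone does not determine that of the next power.\<close>

lemma sum_power_adj_eigenvalues_nonneg: "0 \<le> (\<Sum>x\<in>#adj_eigenvalues G. x ^ k)"
proof -
  obtain vs where vs: "distinct vs" "set vs = pverts G"
    using finite_distinct_list[OF pair_finite_verts] by auto
  let ?A = "adj_mat G vs" and ?n = "length vs"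
  have A: "?A \<in> carrier_mat ?n ?n" by (rule adj_mat_carrier)
  have "(?A ^\<^sub>m k) $$ (i, j) \<ge> 0" if "i < ?n" "j < ?n" for i j
    using that
  proof (induction k arbitrary: i j)
    case 0
    then show ?case using A by simp
  next
    case (Suc k)
    have "(?A ^\<^sub>m Suc k) $$ (i, j) = (\<Sum>l<?n. (?A ^\<^sub>m k) $$ (i, l) * ?A $$ (l, j))"
      using Suc.prems A pow_carrier_mat[OF A, of k] by (simp add: scalar_prod_def atLeast0LessThan)
    also have "\<dots> \<ge> 0"
      using Suc by (intro sum_nonneg mult_nonneg_nonneg) (auto simp: adj_mat_def)
    finally show ?case .
  qed
  then show ?thesis unfolding sum_power_adj_eigenvalues[OF vs] by (intro sum_nonneg) auto
qed

section \<open>The moments of order one, two and four\<close>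

lemma sum_adj_eigenvalues: "(\<Sum>x\<in>#adj_eigenvalues G. x) = 0"
proof -
  obtain vs where vs: "distinct vs" "set vs = pverts G"
    using finite_distinct_list[OF pair_finite_verts] by auto
  have "adj_mat G vs ^\<^sub>m 1 = adj_mat G vs" by (simp add: adj_mat_def)
  then have "(\<Sum>x\<in>#adj_eigenvalues G. x ^ 1) = 0"
    unfolding sum_power_adj_eigenvalues[OF vs] using parcs_irrefl by (auto simp: adj_mat_def)
  then show ?thesis by simp
qed

text \<open>Counts the walks of length two from \<open>u\<close> to \<open>v\<close>, which are the
  entries of the squared adjacency matrix.\<close>

definition codegree :: "'a \<Rightarrow> 'a \<Rightarrow> nat" where
  "codegree u v = card (neighbours G u \<inter> neighbours G v)"

lemma codegree_self: "codegree v v = card (neighbours G v)"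
  by (simp add: codegree_def)

lemma codegree_conv_sum:
  "codegree u v = (\<Sum>w\<in>pverts G. of_bool ((u, w) \<in> parcs G) * of_bool ((w, v) \<in> parcs G))"
proof -
  have "neighbours G u \<inter> neighbours G v = pverts G \<inter> {w. (u, w) \<in> parcs G \<and> (w, v) \<in> parcs G}"
    using neighbours_subset[of u] parcs_sym by (auto simp: neighbours_def)
  then show ?thesis
    using pair_finite_verts
    by (simp add: codegree_def of_bool_conj[symmetric])
qed

text \<open>Double counting of walks of length two, by their ends and by their middle
  vertex.\<close>

lemma sum_codegree:
  "(\<Sum>u\<in>pverts G. \<Sum>v\<in>pverts G. codegree u v) = (\<Sum>w\<in>pverts G. (card (neighbours G w))\<^sup>2)"
proof -
  have deg: "(\<Sum>v\<in>pverts G. of_bool ((w, v) \<in> parcs G)) = card (neighbours G w)" for w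
    using neighbours_subset[of w] pair_finite_verts
    by (auto simp: of_bool_def sum.If_cases neighbours_def intro!: arg_cong[where f = card])
  have cod: "codegree u v = (\<Sum>w\<in>pverts G. of_bool ((w, u) \<in> parcs G) * of_bool ((w, v) \<in> parcs G))" for u v
    unfolding codegree_conv_sum by (intro sum.cong refl, subst parcs_sym, rule refl)
  have "(\<Sum>u\<in>pverts G. \<Sum>v\<in>pverts G. codegree u v) =
      (\<Sum>u\<in>pverts G. \<Sum>w\<in>pverts G. \<Sum>v\<in>pverts G. of_bool ((w, u) \<in> parcs G) * of_bool ((w, v) \<in> parcs G))"
    unfolding cod by (intro sum.cong refl sum.swap)
  also have "\<dots> = (\<Sum>w\<in>pverts G. \<Sum>u\<in>pverts G. \<Sum>v\<in>pverts G. of_bool ((w, u) \<in> parcs G) * of_bool ((w, v) \<in> parcs G))"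
    by (rule sum.swap)
  also have "\<dots> = (\<Sum>w\<in>pverts G. (card (neighbours G w))\<^sup>2)"
    by (intro sum.cong refl) (simp only: sum_product[symmetric] deg power2_eq_square)
  finally show ?thesis .
qed

lemma adj_mat_square:
  assumes vs: "distinct vs" "set vs = pverts G" and ij: "i < length vs" "j < length vs"
  shows "(adj_mat G vs * adj_mat G vs) $$ (i, j) = codegree (vs ! i) (vs ! j)"
proof -
  have "(adj_mat G vs * adj_mat G vs) $$ (i, j) =
      (\<Sum>l<length vs. of_bool ((vs ! i, vs ! l) \<in> parcs G) * of_bool ((vs ! l, vs ! j) \<in> parcs G))"
    using ij by (simp add: adj_mat_def scalar_prod_def atLeast0LessThan of_bool_def)
  also have "\<dots> = (\<Sum>v\<in>pverts G. of_bool ((vs ! i, v) \<in> parcs G) * of_bool ((v, vs ! j) \<in> parcs G))"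
    by (rule sum.reindex_bij_betw[OF bij_betw_nth]) (use vs in auto)
  also have "\<dots> = codegree (vs ! i) (vs ! j)"
    by (simp add: codegree_conv_sum)
  finally show ?thesis .
qed

lemma sum_square_adj_eigenvalues:
  "(\<Sum>x\<in>#adj_eigenvalues G. x\<^sup>2) = card (parcs G)"
proof -
  obtain vs where vs: "distinct vs" "set vs = pverts G"
    using finite_distinct_list[OF pair_finite_verts] by auto
  have "adj_mat G vs ^\<^sub>m 2 = adj_mat G vs * adj_mat G vs"
    by (simp add: numeral_2_eq_2 adj_mat_def)
  then have "(\<Sum>x\<in>#adj_eigenvalues G. x\<^sup>2) = (\<Sum>i<length vs. real (codegree (vs ! i) (vs ! i)))"
    unfolding sum_power_adj_eigenvalues[OF vs] by (simp add: adj_mat_square[OF vs])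
  also have "\<dots> = (\<Sum>v\<in>pverts G. real (codegree v v))"
    by (rule sum.reindex_bij_betw[OF bij_betw_nth]) (use vs in auto)
  also have "\<dots> = card (parcs G)"
    by (simp add: codegree_self sum_card_neighbours[symmetric])
  finally show ?thesis .
qed

text \<open>The fourth power is the square of the symmetric matrix of codegrees, so its trace is the
  sum of the squared entries.\<close>

lemma sum_fourth_power_adj_eigenvalues:
  "(\<Sum>x\<in>#adj_eigenvalues G. x ^ 4) = (\<Sum>u\<in>pverts G. \<Sum>v\<in>pverts G. real ((codegree u v)\<^sup>2))"
proof -
  obtain vs where vs: "distinct vs" "set vs = pverts G"
    using finite_distinct_list[OF pair_finite_verts] by auto
  let ?n = "length vs"
  define A where "A = adj_mat G vs"
  have A: "A \<in> carrier_mat ?n ?n" unfolding A_def by (rule adj_mat_carrier)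
  have "A ^\<^sub>m 4 = A * A * A * A" using A by (simp add: numeral_eq_Suc)
  also have "\<dots> = (A * A) * (A * A)" using A by (subst assoc_mult_mat[of _ ?n ?n _ ?n _ ?n]) auto
  finally have "(A ^\<^sub>m 4) $$ (i, i) = (\<Sum>j<?n. (A * A) $$ (i, j) * (A * A) $$ (j, i))" if "i < ?n" for i
    using A that by (simp add: scalar_prod_def atLeast0LessThan)
  then have "(\<Sum>x\<in>#adj_eigenvalues G. x ^ 4) = (\<Sum>i<?n. \<Sum>j<?n. (A * A) $$ (i, j) * (A * A) $$ (j, i))"
    unfolding sum_power_adj_eigenvalues[OF vs] by (simp add: A_def)
  also have "\<dots> = (\<Sum>i<?n. \<Sum>j<?n. real ((codegree (vs ! i) (vs ! j))\<^sup>2))"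
    unfolding A_def
    by (intro sum.cong refl) (simp add: adj_mat_square[OF vs] codegree_def power2_eq_square Int_commute)
  also have "\<dots> = (\<Sum>i<?n. \<Sum>v\<in>pverts G. real ((codegree (vs ! i) v)\<^sup>2))"
    by (intro sum.cong refl sum.reindex_bij_betw[OF bij_betw_nth]) (use vs in auto)
  also have "\<dots> = (\<Sum>u\<in>pverts G. \<Sum>v\<in>pverts G. real ((codegree u v)\<^sup>2))"
    by (rule sum.reindex_bij_betw[OF bij_betw_nth]) (use vs in auto)
  finally show ?thesis .
qed

text \<open>
  Equality holds iff there is no 4-cycle: off the diagonal the codegree is an integer, so its square
  dominates it.
\<close>

lemma sum_fourth_power_adj_eigenvalues_ge:
  "(\<Sum>x\<in>#adj_eigenvalues G. x ^ 4) \<ge> 2 * (\<Sum>v\<in>pverts G. (real (card (neighbours G v)))\<^sup>2) - card (parcs G)"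
proof -
  let ?d = "\<lambda>v. card (neighbours G v)"
  \<comment> \<open>The diagonal codegree is the degree. Adding it and its square on opposite sides
    avoids truncated subtraction.\<close>
  have row: "(\<Sum>v\<in>pverts G. codegree u v) + (?d u)\<^sup>2 \<le> (\<Sum>v\<in>pverts G. (codegree u v)\<^sup>2) + ?d u"
    if u: "u \<in> pverts G" for u
  proof -
    have "(\<Sum>v\<in>pverts G - {u}. codegree u v) \<le> (\<Sum>v\<in>pverts G - {u}. (codegree u v)\<^sup>2)"
      by (intro sum_mono) (simp add: power2_nat_le_imp_le power2_eq_square)
    then show ?thesis
      using sum.remove[OF pair_finite_verts u, of "codegree u"]
        sum.remove[OF pair_finite_verts u, of "\<lambda>v. (codegree u v)\<^sup>2"] codegree_self[of u] by simp
  qed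
  have "(\<Sum>u\<in>pverts G. (\<Sum>v\<in>pverts G. codegree u v) + (?d u)\<^sup>2) \<le>
      (\<Sum>u\<in>pverts G. (\<Sum>v\<in>pverts G. (codegree u v)\<^sup>2) + ?d u)"
    by (intro sum_mono row)
  then have "2 * (\<Sum>u\<in>pverts G. (?d u)\<^sup>2) \<le> (\<Sum>u\<in>pverts G. \<Sum>v\<in>pverts G. (codegree u v)\<^sup>2) + card (parcs G)"
    by (simp add: sum.distrib sum_codegree sum_card_neighbours)
  then have "real (2 * (\<Sum>u\<in>pverts G. (?d u)\<^sup>2)) \<le> real ((\<Sum>u\<in>pverts G. \<Sum>v\<in>pverts G. (codegree u v)\<^sup>2) + card (parcs G))"
    by (simp only: of_nat_le_iff)
  then show ?thesis unfolding sum_fourth_power_adj_eigenvalues by simp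
qed

end

text \<open>A nonzero value needs a second one to cancel it, and each nonzero integer square is at
  least 1.\<close>

lemma sum_squares_dev_ge_2:
  fixes f :: "'a \<Rightarrow> int"
  assumes "finite S" "sum f S = 0" "x \<in> S" "f x \<noteq> 0"
  shows "(\<Sum>v\<in>S. (f v)\<^sup>2) \<ge> 2"
proof -
  have sq: "(f v)\<^sup>2 \<ge> 1" if "f v \<noteq> 0" for v
    using that by (smt (verit) zero_less_power2)
  have "sum f (S - {x}) \<noteq> 0" using assms by (simp add: sum_diff1)
  then obtain y where y: "y \<in> S - {x}" "f y \<noteq> 0" by (meson sum.neutral)
  have "2 \<le> (f x)\<^sup>2 + (f y)\<^sup>2" using sq[OF assms(4)] sq[OF y(2)] by linarith
  also have "\<dots> = (\<Sum>v\<in>{x, y}. (f v)\<^sup>2)" using y by auto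
  also have "\<dots> \<le> (\<Sum>v\<in>S. (f v)\<^sup>2)" using assms y by (intro sum_mono2) auto
  finally show ?thesis .
qed

text \<open>The degrees average 2 but are not all 2, so the squared deviations sum to at least 2 and
  the squared degrees to at least \<open>4n + 2\<close>. The general bound then gives
  \<open>2(4n + 2) - 2n = 6n + 4\<close>.\<close>

lemma unicyclic_sum_fourth_power_ge:
  assumes uni: "unicyclic_graph G"
    and non: "\<not> digraph_iso (with_proj G) (with_proj (cycle_graph (card (pverts G))))"
  shows "(\<Sum>x\<in>#adj_eigenvalues G. x ^ 4) \<ge> 6 * real (card (pverts G)) + 4"
proof -
  interpret pair_graph G using uni by (simp add: unicyclic_graph_def)
  let ?d = "\<lambda>v. card (neighbours G v)" and ?n = "card (pverts G)"
  have arcs: "card (parcs G) = 2 * ?n"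
    using uni card_parcs by (simp add: unicyclic_graph_def)
  have "\<exists>v\<in>pverts G. ?d v \<noteq> 2"
    using non uni connected_2_regular_imp_cycle[of ?n] by (auto simp: unicyclic_graph_def)
  then obtain v where v: "v \<in> pverts G" "?d v \<noteq> 2" by blast
  have sum_d: "(\<Sum>v\<in>pverts G. int (?d v)) = 2 * int ?n"
    using sum_card_neighbours arcs by (metis of_nat_mult of_nat_numeral of_nat_sum)
  have "2 \<le> (\<Sum>v\<in>pverts G. (int (?d v) - 2)\<^sup>2)"
    by (rule sum_squares_dev_ge_2[OF pair_finite_verts _ v(1)])
      (use v sum_d in \<open>auto simp: sum_subtractf\<close>)
  also have "\<dots> = (\<Sum>v\<in>pverts G. (int (?d v))\<^sup>2) - 4 * (\<Sum>v\<in>pverts G. int (?d v)) + 4 * int ?n"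
    by (simp add: power2_diff sum.distrib sum_subtractf sum_distrib_left algebra_simps)
  finally have "4 * int ?n + 2 \<le> (\<Sum>v\<in>pverts G. (int (?d v))\<^sup>2)"
    using sum_d by simp
  then have "real_of_int (4 * int ?n + 2) \<le> real_of_int (\<Sum>v\<in>pverts G. (int (?d v))\<^sup>2)"
    by (simp only: of_int_le_iff)
  then have "4 * real ?n + 2 \<le> (\<Sum>v\<in>pverts G. (real (?d v))\<^sup>2)" by simp
  then show ?thesis using sum_fourth_power_adj_eigenvalues_ge arcs by simp
qed

subsection \<open>The spectrum of the cycle\<close>

lemma pair_graph_cycle_graph:
  assumes "n \<ge> 3"
  shows "pair_graph (cycle_graph n)"
proof
  show "finite (pverts (cycle_graph n))" by (simp add: cycle_graph_def)
  show "finite (parcs (cycle_graph n))"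
    by (rule finite_subset[of _ "{..<n} \<times> {..<n}"]) (auto simp: cycle_graph_def)
  show "symmetric (with_proj (cycle_graph n))"
    by (auto simp: symmetric_def cycle_graph_def intro!: symI)
next
  fix e assume e: "e \<in> parcs (cycle_graph n)"
  then show "fst e \<in> pverts (cycle_graph n)" "snd e \<in> pverts (cycle_graph n)"
    by (auto simp: cycle_graph_def)
  show "fst e \<noteq> snd e"
    using e assms by (auto simp: cycle_graph_def mod_Suc split: if_splits)
qed

lemma neighbours_cycle_graph:
  assumes "n \<ge> 3" "j < n"
  shows "neighbours (cycle_graph n) j = {Suc j mod n, if j = 0 then n - 1 else j - 1}"
  using assms by (auto simp: neighbours_def cycle_graph_def mod_Suc split: if_splits)

text \<open>
  The number of sequences of \<open>k\<close> steps \<open>\<plusminus>1\<close> whose sum is congruent to \<open>c\<close> modulo \<open>n\<close>.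
\<close>

primrec cycle_walks :: "nat \<Rightarrow> nat \<Rightarrow> int \<Rightarrow> nat" where
  "cycle_walks n 0 c = of_bool (int n dvd c)"
| "cycle_walks n (Suc k) c = cycle_walks n k (c - 1) + cycle_walks n k (c + 1)"

text \<open>Allows vertex numbers reduced modulo \<open>n\<close> to be replaced by plain integer
  differences.\<close>

lemma cycle_walks_cong:
  assumes "int n dvd c - d"
  shows "cycle_walks n k c = cycle_walks n k d"
  using assms
proof (induction k arbitrary: c d)
  case 0
  then have "int n dvd c \<longleftrightarrow> int n dvd d"
    by (metis diff_add_cancel dvd_add_right_iff)
  then show ?case by simp
next
  case (Suc k)
  from Suc.IH[of "c - 1" "d - 1"] Suc.IH[of "c + 1" "d + 1"] Suc.prems show ?case by simp
qed

text \<open>Walks on the cycle lift to integer walks with steps of size one. The induction removes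
  the last step, which enters \<open>j\<close> from its successor \<open>s\<close> or its
  predecessor \<open>t\<close>.\<close>

lemma adj_mat_cycle_graph_pow:
  assumes n: "n \<ge> 3" and ij: "i < n" "j < n"
  shows "(adj_mat (cycle_graph n) [0..<n] ^\<^sub>m k) $$ (i, j) = cycle_walks n k (int i - int j)"
  using ij
proof (induction k arbitrary: j)
  case 0
  have "int n dvd int i - int j \<longleftrightarrow> i = j"
  proof
    assume "int n dvd int i - int j"
    then have "\<bar>int i - int j\<bar> = 0 \<or> int n \<le> \<bar>int i - int j\<bar>"
      by (metis abs_ge_zero dvd_abs_iff order_le_less zdvd_imp_le)
    then show "i = j" using 0 by linarith
  qed simp
  then show ?case using 0 by (simp add: adj_mat_def)
next
  case (Suc k)
  interpret pair_graph "cycle_graph n" by (rule pair_graph_cycle_graph[OF n])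
  define A where "A = adj_mat (cycle_graph n) [0..<n]"
  define s where "s = Suc j mod n"
  define t where "t = (if j = 0 then n - 1 else j - 1)"
  have A: "A \<in> carrier_mat n n" by (simp add: A_def adj_mat_def)
  have st: "s < n" "t < n" "s \<noteq> t"
    using n Suc.prems by (auto simp: s_def t_def mod_Suc)
  have "(A ^\<^sub>m Suc k) $$ (i, j) = (\<Sum>l<n. (A ^\<^sub>m k) $$ (i, l) * A $$ (l, j))"
    using Suc.prems A pow_carrier_mat[OF A, of k] by (simp add: scalar_prod_def atLeast0LessThan)
  also have "\<dots> = (\<Sum>l<n. if l \<in> neighbours (cycle_graph n) j then (A ^\<^sub>m k) $$ (i, l) else 0)"
    using Suc.prems parcs_sym by (intro sum.cong refl) (auto simp: A_def adj_mat_def neighbours_def)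
  also have "\<dots> = (\<Sum>l\<in>{s, t}. (A ^\<^sub>m k) $$ (i, l))"
    unfolding neighbours_cycle_graph[OF n Suc.prems(2)] s_def[symmetric] t_def[symmetric]
    using st by (subst sum.inter_restrict[symmetric]) (auto intro!: sum.cong)
  also have "\<dots> = real (cycle_walks n k (int i - int s) + cycle_walks n k (int i - int t))"
    using st Suc.IH[of s] Suc.IH[of t] Suc.prems by (simp add: A_def)
  also have "cycle_walks n k (int i - int s) = cycle_walks n k (int i - int j - 1)"
    by (rule cycle_walks_cong)
      (use Suc.prems in \<open>auto simp: s_def mod_Suc of_nat_diff add.commute\<close>)
  also have "cycle_walks n k (int i - int t) = cycle_walks n k (int i - int j + 1)"
    by (rule cycle_walks_cong) (use Suc.prems in \<open>auto simp: t_def of_nat_diff\<close>)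
  finally show ?case by (simp add: A_def)
qed

lemma sum_power_adj_eigenvalues_cycle_graph:
  assumes n: "n \<ge> 3"
  shows "(\<Sum>x\<in>#adj_eigenvalues (cycle_graph n). x ^ k) = real n * real (cycle_walks n k 0)"
proof -
  interpret pair_graph "cycle_graph n" by (rule pair_graph_cycle_graph[OF n])
  have "(\<Sum>x\<in>#adj_eigenvalues (cycle_graph n). x ^ k) =
      (\<Sum>i<n. (adj_mat (cycle_graph n) [0..<n] ^\<^sub>m k) $$ (i, i))"
    by (subst sum_power_adj_eigenvalues[of "[0..<n]"]) (auto simp: cycle_graph_def)
  also have "\<dots> = (\<Sum>i<n. real (cycle_walks n k 0))"
    using adj_mat_cycle_graph_pow[OF n] by (intro sum.cong) auto
  finally show ?thesis by simp
qed

text \<open>With at most four steps the sum is smaller than \<open>n\<close> in absolute value, so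
  it must vanish, leaving central binomial coefficients or 0. Five steps can only wind once around a
  5-cycle, in either direction.\<close>

lemma cycle_walks_0:
  assumes "n \<ge> 5"
  shows "cycle_walks n 1 0 = 0" "cycle_walks n 2 0 = 2" "cycle_walks n 3 0 = 0"
    "cycle_walks n 4 0 = 6" "cycle_walks n 5 0 \<le> 2"
proof -
  have nd: "\<not> int n dvd 1" "\<not> int n dvd 2" "\<not> int n dvd 3" "\<not> int n dvd 4"
    using assms by (auto dest!: zdvd_imp_le)
  have nd': "\<not> int n dvd - 1" "\<not> int n dvd - 2" "\<not> int n dvd - 3" "\<not> int n dvd - 4"
    using nd by (simp_all only: dvd_minus_iff not_False_eq_True)
  note nds = nd nd'
  show "cycle_walks n 1 0 = 0" "cycle_walks n 2 0 = 2" "cycle_walks n 3 0 = 0"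
    "cycle_walks n 4 0 = 6" "cycle_walks n 5 0 \<le> 2"
    using nds by (auto simp: numeral_eq_Suc)
qed

lemma abs_adj_eigenvalue_cycle_graph_le:
  assumes n: "n \<ge> 3" and x: "x \<in># adj_eigenvalues (cycle_graph n)"
  shows "\<bar>x\<bar> \<le> 2"
proof -
  interpret pair_graph "cycle_graph n" by (rule pair_graph_cycle_graph[OF n])
  show ?thesis
  proof (rule abs_adj_eigenvalue_le[OF x])
    fix v assume "v \<in> pverts (cycle_graph n)"
    then have "v < n" by (simp add: cycle_graph_def)
    then show "real (card (neighbours (cycle_graph n) v)) \<le> 2"
      by (simp add: neighbours_cycle_graph[OF n] card_insert_if)
  qed
qed

subsection \<open>Interpolation of the resolvent\<close>

text \<open>With \<open>w(x) = x^3 - 3x\<close>, the polynomial part is the exact quotient of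
  \<open>w(n)^2 - w(x)^2\<close> by \<open>n - x\<close>.\<close>

lemma resolvent_hermite:
  fixes n x :: real
  assumes "x \<noteq> n"
  shows "(n ^ 3 - 3 * n)\<^sup>2 * (1 / (n - x)) =
    (n ^ 5 - 6 * n ^ 3 + 9 * n) + (n ^ 4 - 6 * n\<^sup>2 + 9) * x + (n ^ 3 - 6 * n) * x\<^sup>2 +
    (n\<^sup>2 - 6) * x ^ 3 + n * x ^ 4 + x ^ 5 + (x ^ 3 - 3 * x)\<^sup>2 / (n - x)"
proof -
  have "(n ^ 3 - 3 * n)\<^sup>2 =
    ((n ^ 5 - 6 * n ^ 3 + 9 * n) + (n ^ 4 - 6 * n\<^sup>2 + 9) * x + (n ^ 3 - 6 * n) * x\<^sup>2 +
    (n\<^sup>2 - 6) * x ^ 3 + n * x ^ 4 + x ^ 5) * (n - x) + (x ^ 3 - 3 * x)\<^sup>2"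
    by (simp add: eval_nat_numeral algebra_simps)
  then show ?thesis using assms by (simp add: divide_simps)
qed

lemma sum_resolvent_hermite:
  fixes n :: real and M :: "real multiset"
  assumes "\<And>x. x \<in># M \<Longrightarrow> x < n"
  shows "(n ^ 3 - 3 * n)\<^sup>2 * (\<Sum>x\<in>#M. 1 / (n - x)) =
    (n ^ 5 - 6 * n ^ 3 + 9 * n) * size M + (n ^ 4 - 6 * n\<^sup>2 + 9) * (\<Sum>x\<in>#M. x) +
    (n ^ 3 - 6 * n) * (\<Sum>x\<in>#M. x\<^sup>2) + (n\<^sup>2 - 6) * (\<Sum>x\<in>#M. x ^ 3) +
    n * (\<Sum>x\<in>#M. x ^ 4) + (\<Sum>x\<in>#M. x ^ 5) + (\<Sum>x\<in>#M. (x ^ 3 - 3 * x)\<^sup>2 / (n - x))"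
  using assms
proof (induction M)
  case (add y M)
  have "y \<noteq> n" using add.prems[of y] by auto
  from resolvent_hermite[OF this] add show ?case
    by (simp add: distrib_left distrib_right)
qed simp

text \<open>The factorisation of \<open>4 - w(x)^2\<close> used here is the identity
  \<open>4 - 4 cos^2 3t = 4 sin^2 3t\<close> at \<open>x = 2 cos t\<close>.\<close>

lemma cubic_square_le_4:
  fixes x :: real
  assumes "\<bar>x\<bar> \<le> 2"
  shows "(x ^ 3 - 3 * x)\<^sup>2 \<le> 4"
proof -
  have "x\<^sup>2 \<le> 2\<^sup>2" using assms abs_le_square_iff[of x 2] by simp
  then have "0 \<le> (4 - x\<^sup>2) * (x\<^sup>2 - 1)\<^sup>2" by simp
  also have "\<dots> = 4 - (x ^ 3 - 3 * x)\<^sup>2"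
    by (simp add: eval_nat_numeral algebra_simps)
  finally show ?thesis by simp
qed

section \<open>Comparison of the two moment expansions\<close>

theorem theorem6:
  fixes G :: "'a pair_pre_digraph" and n :: nat
  assumes "n \<ge> 5"
    and "unicyclic_graph G"
    and "card (pverts G) = n"
    and "\<not> digraph_iso (with_proj G) (with_proj (cycle_graph n))"
  shows "resolvent_energy G > resolvent_energy (cycle_graph n)"
proof -
  interpret G: pair_graph G using assms(2) by (simp add: unicyclic_graph_def)
  have n3: "n \<ge> 3" using assms(1) by simp
  let ?r = "real n"
  let ?M = "adj_eigenvalues G" and ?C = "adj_eigenvalues (cycle_graph n)"
  have r5: "?r \<ge> 5" using assms(1) by simp
  have arcs: "card (parcs G) = 2 * n"
    using assms(2,3) G.card_parcs by (simp add: unicyclic_graph_def)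
  \<comment> \<open>Degrees are at most \<open>n - 1\<close>, so all denominators are
    positive.\<close>
  have "x < ?r" if "x \<in># ?M" for x
  proof -
    have "\<bar>x\<bar> \<le> ?r - 1"
    proof (rule G.abs_adj_eigenvalue_le[OF that])
      fix v assume "v \<in> pverts G"
      from G.card_neighbours_less[OF this] show "real (card (neighbours G v)) \<le> ?r - 1"
        using assms(3) by linarith
    qed
    then show ?thesis by linarith
  qed
  note exp_G = sum_resolvent_hermite[OF this, of ?M] and lt_G = this
  have abs_C: "\<bar>x\<bar> \<le> 2" if "x \<in># ?C" for x
    using abs_adj_eigenvalue_cycle_graph_le[OF n3 that] .
  have lt_C: "x < ?r" if "x \<in># ?C" for x
    using abs_C[OF that] r5 by linarith
  have cubes: "0 \<le> (?r\<^sup>2 - 6) * (\<Sum>x\<in>#?M. x ^ 3)"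
  proof (rule mult_nonneg_nonneg)
    show "0 \<le> ?r\<^sup>2 - 6" using power_mono[OF r5, of 2] by simp
  qed (rule G.sum_power_adj_eigenvalues_nonneg)
  have fourth: "?r * (6 * ?r + 4) \<le> ?r * (\<Sum>x\<in>#?M. x ^ 4)"
    using unicyclic_sum_fourth_power_ge[OF assms(2)] assms(3,4) by (intro mult_left_mono) auto
  have "(\<Sum>x\<in>#?M. 0) \<le> (\<Sum>x\<in>#?M. (x ^ 3 - 3 * x)\<^sup>2 / (?r - x))"
  proof (rule sum_mset_mono)
    fix x assume "x \<in># ?M"
    then show "0 \<le> (x ^ 3 - 3 * x)\<^sup>2 / (?r - x)" using lt_G[of x] by simp
  qed
  \<comment> \<open>The third and fifth moments and the remainder of \<open>G\<close> are
    nonnegative and are dropped.\<close>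
  then have lower: "(?r ^ 5 - 6 * ?r ^ 3 + 9 * ?r) * ?r + (?r ^ 3 - 6 * ?r) * (2 * ?r) + ?r * (6 * ?r + 4)
      \<le> (?r ^ 3 - 3 * ?r)\<^sup>2 * (\<Sum>x\<in>#?M. 1 / (?r - x))"
    using exp_G cubes fourth G.sum_power_adj_eigenvalues_nonneg[of 5]
    unfolding G.sum_adj_eigenvalues G.sum_square_adj_eigenvalues arcs
      size_adj_eigenvalues[OF G.pair_graph] assms(3) of_nat_mult of_nat_numeral
    by simp
  have size_C: "size ?C = n"
    using size_adj_eigenvalues[OF pair_graph_cycle_graph[OF n3]] by (simp add: cycle_graph_def)
  have "(\<Sum>x\<in>#?C. (x ^ 3 - 3 * x)\<^sup>2 / (?r - x)) \<le> (\<Sum>x\<in>#?C. 4 / (?r - 2))"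
  proof (rule sum_mset_mono)
    fix x assume "x \<in># ?C"
    then show "(x ^ 3 - 3 * x)\<^sup>2 / (?r - x) \<le> 4 / (?r - 2)"
      using abs_C[of x] cubic_square_le_4[of x] r5 by (intro frac_le) auto
  qed
  also have "\<dots> = ?r * (4 / (?r - 2))" by (simp add: size_C)
  \<comment> \<open>Here \<open>n > 4\<close> makes \<open>4 / (n - 2)\<close> less than 2.\<close>
  also have "\<dots> < ?r * 2" using r5 by (intro mult_strict_left_mono) (simp_all add: divide_simps)
  finally have rem: "(\<Sum>x\<in>#?C. (x ^ 3 - 3 * x)\<^sup>2 / (?r - x)) < 2 * ?r" by simp
  note pow = sum_power_adj_eigenvalues_cycle_graph[OF n3]
  have "(\<Sum>x\<in>#?C. x ^ 5) \<le> 2 * ?r"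
    unfolding pow
    using cycle_walks_0(5)[OF assms(1)] mult_left_mono[of "real (cycle_walks n 5 0)" 2 ?r] by simp
  moreover have "(\<Sum>x\<in>#?C. x) = 0" "(\<Sum>x\<in>#?C. x\<^sup>2) = 2 * ?r" "(\<Sum>x\<in>#?C. x ^ 3) = 0"
    "(\<Sum>x\<in>#?C. x ^ 4) = 6 * ?r"
    using pow[of 1] pow[of 2] pow[of 3] pow[of 4] cycle_walks_0[OF assms(1)] by simp_all
  \<comment> \<open>The final \<open>4 * ?r\<close> is \<open>2 * ?r\<close> for the fifth moment
    plus \<open>2 * ?r\<close> for the remainder. It equals the excess in \<open>lower\<close>, so
    strictness comes from the remainder alone.\<close>
  ultimately have upper: "(?r ^ 3 - 3 * ?r)\<^sup>2 * (\<Sum>x\<in>#?C. 1 / (?r - x)) <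
      (?r ^ 5 - 6 * ?r ^ 3 + 9 * ?r) * ?r + (?r ^ 3 - 6 * ?r) * (2 * ?r) + ?r * (6 * ?r) + 4 * ?r"
    using sum_resolvent_hermite[of ?C ?r, OF lt_C] rem size_C by simp
  from upper lower have "(?r ^ 3 - 3 * ?r)\<^sup>2 * (\<Sum>x\<in>#?C. 1 / (?r - x)) <
      (?r ^ 3 - 3 * ?r)\<^sup>2 * (\<Sum>x\<in>#?M. 1 / (?r - x))"
    by (simp add: distrib_left)
  then have "(\<Sum>x\<in>#?C. 1 / (?r - x)) < (\<Sum>x\<in>#?M. 1 / (?r - x))"
    by (rule mult_left_less_imp_less) simp
  then show ?thesis
    using assms(3) by (simp add: resolvent_energy_def cycle_graph_def)
qed

end
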